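(* Let $P:\mathcal{C}^{\mathrm{op}}\to\mathbf{Hey}$ be a Gödel first-order hyperdoctrine such that existential-free elements are closed with respect to finite conjunctions. Then $P$ satisfies the Principle of Independence of Premise, i.e. for all objects $A,B$ of $\mathcal{C}$, whenever $\beta\in P(A\times B)$ and $\alpha\in P(A)$ is an existential-free predicate, it is the case that $$a:A\mid \top\vdash (\alpha(a)\to\exists b:B.\,\beta(a,b))\to\exists b:B.\,(\alpha(a)\to\beta(a,b)).$$
   Context: A doctrine is a functor $P:\mathcal{C}^{\mathrm{op}}\to\mathbf{Pos}$, where $\mathcal{C}$ has finite products and $\mathbf{Pos}$ is the category of posets and monotone maps. For $f:A\to B$ in $\mathcal{C}$ write $P_f:P(B)\to P(A)$. Elements of $P(A)$ are called predicates. $P$ is existential (resp. universal) if for every product projection $\pi_i:A_1\times A_2\to A_i$ the map $P_{\pi_i}$ has a left adjoint $\exists_{\pi_i}$ (resp. a right adjoint $\forall_{\pi_i}$) and the Beck-Chevalley condition holds: for every pullback square $\pi f'=f\pi'$ with $\pi:X\to A$ and $\pi':X'\to A'$ projections, $f:A'\to A$, $f':X'\to X$, and every $\beta\in P(X)$, $\exists_{\pi'}P_{f'}\beta=P_f\exists_\pi\beta$ (resp. $\forall_{\pi'}P_{f'}\beta=P_f\forall_\pi\beta$). Internal language: $a:A\mid\phi(a)\vdash\psi(a)$ means $\phi\le\psi$ in $P(A)$ (a context with several variables denotes the product of the types). For $\alpha\in P(A\times B)$, $\exists b:B.\,\alpha(a,b)$ and $\forall b:B.\,\alpha(a,b)$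 denote $\exists_{\pi_A}\alpha$ and $\forall_{\pi_A}\alpha$ in $P(A)$. Terms are arrows of $\mathcal{C}$ and substitution is reindexing, e.g. $\alpha(a,g(a))$ is $P_{\langle 1_A,g\rangle}\alpha$. Propositional connectives are interpreted by the operations of the fibres. Let $P$ be existential. $\alpha\in P(A)$ is an existential splitting if for every object $B$ and every $\beta\in P(A\times B)$ with $\alpha(a)\vdash\exists b:B.\,\beta(a,b)$ there is $g:A\to B$ with $\alpha(a)\vdash\beta(a,g(a))$. $\alpha\in P(I)$ is existential-free if $P_f(\alpha)$ is an existential splitting for every arrow $f:A\to I$. $P$ has enough existential-free predicates if for every $I$ and $\alpha\in P(I)$ there are an object $A$ and an existential-free $\beta\in P(I\times A)$ with $\alpha=\exists_{\pi_I}\beta$. $P^{\exists\text{-free}}$ denotes the subdoctrine of $P$ (same base) whose fibre over $A$ is the set of existential-free elements of $P(A)$ with the induced order. Dually, for $P$ universal, $\alpha\in P(A)$ is a universal splitting if for every $B$ and every $\beta\in P(A\times B)$ with $\forall b:B.\,\beta(a,b)\vdash\alpha(a)$ there is $g:A\to B$ with $\beta(a,g(a))\vdash\alpha(a)$. $\alpha\in P(I)$ is universal-free if $P_f(\alpha)$ is a universal splitting for every $f:A\to I$. $P$ has enough universal-free predicates if for every $I$ and $\alpha\in P(I)$ there are $A$ and a universal-free $\beta\in P(I\times A)$ with $\alpha=\forall_{\pi_I}\beta$. $P$ is a Skolem doctrine if: (i) $\mathcal{C}$ is cartesian closed; (ii) $P$ is existential and universal; (iii) $P$ has enough existential-free predicates;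 (iv) if $\alpha\in P(A)$ is existential-free then $\forall_\pi(\alpha)$ is existential-free for every projection $\pi$ from $A$ (so $P^{\exists\text{-free}}$ is a universal doctrine, with universal quantifiers those of $P$). $P$ is a Gödel doctrine if it is a Skolem doctrine and the doctrine $P^{\exists\text{-free}}$ has enough universal-free predicates. A first-order hyperdoctrine is a functor $P:\mathcal{C}^{\mathrm{op}}\to\mathbf{Hey}$ from a category $\mathcal{C}$ with finite products to Heyting algebras and their homomorphisms such that for every arrow $f$ the map $P_f$ has a left adjoint $\exists_f$ and a right adjoint $\forall_f$, satisfying Beck-Chevalley for every pullback square $fh=gk$ ($h:D\to A$, $k:D\to C$, $f:A\to B$, $g:C\to B$): $\exists_kP_h=P_g\exists_f$ and $\forall_kP_h=P_g\forall_f$. It is a Gödel first-order hyperdoctrine if $P$ is a Gödel doctrine. *)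

theory Defs
  imports "HOL-Algebra.Galois_Connection"
begin

section \<open>Categories\<close>

record ('o, 'm) cat =
  Obj :: "'o set"
  Arr :: "'m set"
  Dom :: "'m \<Rightarrow> 'o"
  Cod :: "'m \<Rightarrow> 'o"
  Ident :: "'o \<Rightarrow> 'm"
  Comp :: "'m \<Rightarrow> 'm \<Rightarrow> 'm"  (infixr \<open>\<cdot>\<index>\<close> 75)

definition hom :: "('o, 'm) cat \<Rightarrow> 'o \<Rightarrow> 'o \<Rightarrow> 'm set"
  where "hom C A B = {f \<in> Arr C. Dom C f = A \<and> Cod C f = B}"

locale category =
  fixes C :: "('o, 'm) cat" (structure)
  assumes Dom_closed: "f \<in> Arr C \<Longrightarrow> Dom C f \<in> Obj C"
    and Cod_closed: "f \<in> Arr C \<Longrightarrow> Cod C f \<in> Obj C"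
    and Ident_closed: "A \<in> Obj C \<Longrightarrow> Ident C A \<in> hom C A A"
    and Comp_closed: "\<lbrakk>f \<in> hom C A B; g \<in> hom C B D\<rbrakk> \<Longrightarrow> g \<cdot> f \<in> hom C A D"
    and Comp_Ident: "f \<in> hom C A B \<Longrightarrow> f \<cdot> Ident C A = f"
    and Ident_Comp: "f \<in> hom C A B \<Longrightarrow> Ident C B \<cdot> f = f"
    and Comp_assoc: "\<lbrakk>f \<in> hom C A B; g \<in> hom C B D; h \<in> hom C D E\<rbrakk>
      \<Longrightarrow> (h \<cdot> g) \<cdot> f = h \<cdot> (g \<cdot> f)"

definition is_terminal :: "('o, 'm) cat \<Rightarrow> 'o \<Rightarrow> bool"
  where "is_terminal C T \<longleftrightarrow> T \<in> Obj C \<and> (\<forall>A\<in>Obj C. \<exists>!f. f \<in> hom C A T)"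

definition is_product :: "('o, 'm) cat \<Rightarrow> 'o \<Rightarrow> 'o \<Rightarrow> 'o \<Rightarrow> 'm \<Rightarrow> 'm \<Rightarrow> bool"
  where "is_product C A B X p q \<longleftrightarrow>
    A \<in> Obj C \<and> B \<in> Obj C \<and> X \<in> Obj C \<and> p \<in> hom C X A \<and> q \<in> hom C X B \<and>
    (\<forall>Z\<in>Obj C. \<forall>f\<in>hom C Z A. \<forall>g\<in>hom C Z B.
      \<exists>!h. h \<in> hom C Z X \<and> p \<cdot>\<^bsub>C\<^esub> h = f \<and> q \<cdot>\<^bsub>C\<^esub> h = g)"

definition finite_products :: "('o, 'm) cat \<Rightarrow> bool"
  where "finite_products C \<longleftrightarrow> (\<exists>T. is_terminal C T) \<and>
    (\<forall>A\<in>Obj C. \<forall>B\<in>Obj C. \<exists>X p q. is_product C A B X p q)"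

text \<open>No products are chosen: whatever is required of the products $A \times B$ is required of
  all product cones, and \<open>tuple C p q f g\<close> is the arrow $\langle f, g\rangle$ into the vertex of
  the product cone \<open>(p, q)\<close>.\<close>

definition tuple :: "('o, 'm) cat \<Rightarrow> 'm \<Rightarrow> 'm \<Rightarrow> 'm \<Rightarrow> 'm \<Rightarrow> 'm"
  where "tuple C p q f g =
    (THE h. h \<in> hom C (Dom C f) (Dom C p) \<and> p \<cdot>\<^bsub>C\<^esub> h = f \<and> q \<cdot>\<^bsub>C\<^esub> h = g)"

definition is_projection :: "('o, 'm) cat \<Rightarrow> 'm \<Rightarrow> bool"
  where "is_projection C p \<longleftrightarrow>
    (\<exists>A B X q. is_product C A B X p q \<or> is_product C B A X q p)"

definition is_pullback :: "('o, 'm) cat \<Rightarrow> 'm \<Rightarrow> 'm \<Rightarrow> 'm \<Rightarrow> 'm \<Rightarrow> bool"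
  \<comment> \<open>\<open>f \<cdot> h = g \<cdot> k\<close> is a pullback square\<close>
  where "is_pullback C f g h k \<longleftrightarrow>
    f \<in> Arr C \<and> g \<in> Arr C \<and> h \<in> Arr C \<and> k \<in> Arr C \<and>
    Cod C f = Cod C g \<and> Cod C h = Dom C f \<and> Cod C k = Dom C g \<and> Dom C h = Dom C k \<and>
    f \<cdot>\<^bsub>C\<^esub> h = g \<cdot>\<^bsub>C\<^esub> k \<and>
    (\<forall>Z\<in>Obj C. \<forall>u\<in>hom C Z (Dom C f). \<forall>v\<in>hom C Z (Dom C g). f \<cdot>\<^bsub>C\<^esub> u = g \<cdot>\<^bsub>C\<^esub> v \<longrightarrow>
      (\<exists>!w. w \<in> hom C Z (Dom C h) \<and> h \<cdot>\<^bsub>C\<^esub> w = u \<and> k \<cdot>\<^bsub>C\<^esub> w = v))"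

definition is_exponential ::
    "('o, 'm) cat \<Rightarrow> 'o \<Rightarrow> 'o \<Rightarrow> 'o \<Rightarrow> 'o \<Rightarrow> 'm \<Rightarrow> 'm \<Rightarrow> 'm \<Rightarrow> bool"
  \<comment> \<open>$E = B^A$, with evaluation \<open>e\<close> defined on the product $X = E \times A$\<close>
  where "is_exponential C A B E X p q e \<longleftrightarrow>
    is_product C E A X p q \<and> e \<in> hom C X B \<and>
    (\<forall>Z W r s. is_product C Z A W r s \<longrightarrow>
      (\<forall>f\<in>hom C W B. \<exists>!g. g \<in> hom C Z E \<and> e \<cdot>\<^bsub>C\<^esub> tuple C p q (g \<cdot>\<^bsub>C\<^esub> r) s = f))"

definition cartesian_closed :: "('o, 'm) cat \<Rightarrow> bool"
  where "cartesian_closed C \<longleftrightarrow> finite_products C \<and>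
    (\<forall>A\<in>Obj C. \<forall>B\<in>Obj C. \<exists>E X p q e. is_exponential C A B E X p q e)"


section \<open>Heyting algebras\<close>

definition himp :: "('a, 'b) gorder_scheme \<Rightarrow> 'a \<Rightarrow> 'a \<Rightarrow> 'a"  (infixr \<open>\<Rrightarrow>\<index>\<close> 60)
  where "x \<Rrightarrow>\<^bsub>L\<^esub> y = (SOME z. greatest L z {w \<in> carrier L. w \<sqinter>\<^bsub>L\<^esub> x \<sqsubseteq>\<^bsub>L\<^esub> y})"

locale heyting_algebra = bounded_lattice L for L (structure) +
  assumes himp_exists: "\<lbrakk>x \<in> carrier L; y \<in> carrier L\<rbrakk>
    \<Longrightarrow> \<exists>z. greatest L z {w \<in> carrier L. w \<sqinter> x \<sqsubseteq> y}"

definition heyting_hom ::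
    "('a, 'c) gorder_scheme \<Rightarrow> ('b, 'd) gorder_scheme \<Rightarrow> ('a \<Rightarrow> 'b) \<Rightarrow> bool"
  where "heyting_hom L M f \<longleftrightarrow>
    f \<in> carrier L \<rightarrow> carrier M \<and> f \<top>\<^bsub>L\<^esub> = \<top>\<^bsub>M\<^esub> \<and> f \<bottom>\<^bsub>L\<^esub> = \<bottom>\<^bsub>M\<^esub> \<and>
    (\<forall>x\<in>carrier L. \<forall>y\<in>carrier L.
      f (x \<sqinter>\<^bsub>L\<^esub> y) = f x \<sqinter>\<^bsub>M\<^esub> f y \<and>
      f (x \<squnion>\<^bsub>L\<^esub> y) = f x \<squnion>\<^bsub>M\<^esub> f y \<and>
      f (x \<Rrightarrow>\<^bsub>L\<^esub> y) = f x \<Rrightarrow>\<^bsub>M\<^esub> f y)"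


section \<open>Doctrines\<close>

text \<open>The fibres share one type \<open>'p\<close> of predicates, but their carriers and orders are independent
  of each other. Since an arrow determines its domain and codomain, so does \<open>sub P f\<close>, which
  stands for $P_f$.\<close>

record ('o, 'm, 'p) doctrine =
  base :: "('o, 'm) cat"
  fib :: "'o \<Rightarrow> 'p gorder"
  sub :: "'m \<Rightarrow> 'p \<Rightarrow> 'p"

abbreviation dom_fib :: "('o, 'm, 'p) doctrine \<Rightarrow> 'm \<Rightarrow> 'p gorder"
  where "dom_fib P f \<equiv> fib P (Dom (base P) f)"

abbreviation cod_fib :: "('o, 'm, 'p) doctrine \<Rightarrow> 'm \<Rightarrow> 'p gorder"
  where "cod_fib P f \<equiv> fib P (Cod (base P) f)"

locale doctrine = category "base P" for P :: "('o, 'm, 'p) doctrine" +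
  assumes base_finite_products: "finite_products (base P)"
    and fib_order: "A \<in> Obj (base P) \<Longrightarrow> partial_order (fib P A)"
    and sub_closed: "f \<in> Arr (base P) \<Longrightarrow> sub P f \<in> carrier (cod_fib P f) \<rightarrow> carrier (dom_fib P f)"
    and sub_mono: "f \<in> Arr (base P) \<Longrightarrow> isotone (cod_fib P f) (dom_fib P f) (sub P f)"
    and sub_Ident: "\<lbrakk>A \<in> Obj (base P); \<alpha> \<in> carrier (fib P A)\<rbrakk>
      \<Longrightarrow> sub P (Ident (base P) A) \<alpha> = \<alpha>"
    and sub_Comp: "\<lbrakk>f \<in> hom (base P) A B; g \<in> hom (base P) B D; \<alpha> \<in> carrier (fib P D)\<rbrakk>
      \<Longrightarrow> sub P (g \<cdot>\<^bsub>base P\<^esub> f) \<alpha> = sub P f (sub P g \<alpha>)"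


subsection \<open>Quantifiers\<close>

definition left_adjoint :: "('o, 'm, 'p) doctrine \<Rightarrow> 'm \<Rightarrow> ('p \<Rightarrow> 'p) \<Rightarrow> bool"
  where "left_adjoint P f l \<longleftrightarrow>
    galois_connection \<lparr>orderA = dom_fib P f, orderB = cod_fib P f, lower = l, upper = sub P f\<rparr>"

definition right_adjoint :: "('o, 'm, 'p) doctrine \<Rightarrow> 'm \<Rightarrow> ('p \<Rightarrow> 'p) \<Rightarrow> bool"
  where "right_adjoint P f r \<longleftrightarrow>
    galois_connection \<lparr>orderA = cod_fib P f, orderB = dom_fib P f, lower = sub P f, upper = r\<rparr>"

text \<open>Adjoints are unique on the carrier of the fibre; off the carrier the choice is irrelevant.\<close>

definition Exq :: "('o, 'm, 'p) doctrine \<Rightarrow> 'm \<Rightarrow> 'p \<Rightarrow> 'p"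
  where "Exq P f = (SOME l. left_adjoint P f l)"

definition Allq :: "('o, 'm, 'p) doctrine \<Rightarrow> 'm \<Rightarrow> 'p \<Rightarrow> 'p"
  where "Allq P f = (SOME r. right_adjoint P f r)"

locale existential_doctrine = doctrine P for P :: "('o, 'm, 'p) doctrine" +
  assumes ex_adjoint: "is_projection (base P) p \<Longrightarrow> \<exists>l. left_adjoint P p l"
    and ex_Beck_Chevalley:
      "\<lbrakk>is_projection (base P) p; is_projection (base P) p'; is_pullback (base P) p f f' p';
        \<beta> \<in> carrier (dom_fib P p)\<rbrakk>
      \<Longrightarrow> Exq P p' (sub P f' \<beta>) = sub P f (Exq P p \<beta>)"

locale universal_doctrine = doctrine P for P :: "('o, 'm, 'p) doctrine" +
  assumes all_adjoint: "is_projection (base P) p \<Longrightarrow> \<exists>r. right_adjoint P p r"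
    and all_Beck_Chevalley:
      "\<lbrakk>is_projection (base P) p; is_projection (base P) p'; is_pullback (base P) p f f' p';
        \<beta> \<in> carrier (dom_fib P p)\<rbrakk>
      \<Longrightarrow> Allq P p' (sub P f' \<beta>) = sub P f (Allq P p \<beta>)"


subsection \<open>Quantifier-free predicates\<close>

definition existential_splitting :: "('o, 'm, 'p) doctrine \<Rightarrow> 'o \<Rightarrow> 'p \<Rightarrow> bool"
  where "existential_splitting P A \<alpha> \<longleftrightarrow> \<alpha> \<in> carrier (fib P A) \<and>
    (\<forall>B X p q. is_product (base P) A B X p q \<longrightarrow>
      (\<forall>\<beta>\<in>carrier (fib P X). \<alpha> \<sqsubseteq>\<^bsub>fib P A\<^esub> Exq P p \<beta> \<longrightarrow>
        (\<exists>g\<in>hom (base P) A B.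
          \<alpha> \<sqsubseteq>\<^bsub>fib P A\<^esub> sub P (tuple (base P) p q (Ident (base P) A) g) \<beta>)))"

definition existential_free :: "('o, 'm, 'p) doctrine \<Rightarrow> 'o \<Rightarrow> 'p \<Rightarrow> bool"
  where "existential_free P I \<alpha> \<longleftrightarrow> \<alpha> \<in> carrier (fib P I) \<and>
    (\<forall>A\<in>Obj (base P). \<forall>f\<in>hom (base P) A I. existential_splitting P A (sub P f \<alpha>))"

definition enough_existential_free :: "('o, 'm, 'p) doctrine \<Rightarrow> bool"
  where "enough_existential_free P \<longleftrightarrow>
    (\<forall>I\<in>Obj (base P). \<forall>\<alpha>\<in>carrier (fib P I).
      \<exists>A X p q \<beta>. is_product (base P) I A X p q \<and> existential_free P X \<beta> \<and> \<alpha> = Exq P p \<beta>)"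

definition universal_splitting :: "('o, 'm, 'p) doctrine \<Rightarrow> 'o \<Rightarrow> 'p \<Rightarrow> bool"
  where "universal_splitting P A \<alpha> \<longleftrightarrow> \<alpha> \<in> carrier (fib P A) \<and>
    (\<forall>B X p q. is_product (base P) A B X p q \<longrightarrow>
      (\<forall>\<beta>\<in>carrier (fib P X). Allq P p \<beta> \<sqsubseteq>\<^bsub>fib P A\<^esub> \<alpha> \<longrightarrow>
        (\<exists>g\<in>hom (base P) A B.
          sub P (tuple (base P) p q (Ident (base P) A) g) \<beta> \<sqsubseteq>\<^bsub>fib P A\<^esub> \<alpha>)))"

definition universal_free :: "('o, 'm, 'p) doctrine \<Rightarrow> 'o \<Rightarrow> 'p \<Rightarrow> bool"
  where "universal_free P I \<alpha> \<longleftrightarrow> \<alpha> \<in> carrier (fib P I) \<and>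
    (\<forall>A\<in>Obj (base P). \<forall>f\<in>hom (base P) A I. universal_splitting P A (sub P f \<alpha>))"

definition enough_universal_free :: "('o, 'm, 'p) doctrine \<Rightarrow> bool"
  where "enough_universal_free P \<longleftrightarrow>
    (\<forall>I\<in>Obj (base P). \<forall>\<alpha>\<in>carrier (fib P I).
      \<exists>A X p q \<beta>. is_product (base P) I A X p q \<and> universal_free P X \<beta> \<and> \<alpha> = Allq P p \<beta>)"

definition existential_free_subdoctrine :: "('o, 'm, 'p) doctrine \<Rightarrow> ('o, 'm, 'p) doctrine"
  where "existential_free_subdoctrine P =
    P\<lparr>fib := \<lambda>A. (fib P A)\<lparr>carrier := {\<alpha>. existential_free P A \<alpha>}\<rparr>\<rparr>"


subsection \<open>Skolem and Goedel doctrines\<close>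

locale skolem_doctrine = existential_doctrine P + universal_doctrine P
  for P :: "('o, 'm, 'p) doctrine" +
  assumes base_cartesian_closed: "cartesian_closed (base P)"
    and enough_existential_free: "enough_existential_free P"
    and existential_free_Allq:
      "\<lbrakk>is_projection (base P) p; existential_free P (Dom (base P) p) \<alpha>\<rbrakk>
      \<Longrightarrow> existential_free P (Cod (base P) p) (Allq P p \<alpha>)"

text \<open>Below, \<open>enough_universal_free\<close> refers to the universal quantifiers of the subdoctrine, that
  is, to right adjoints between its fibres. By \<open>existential_free_Allq\<close> these exist and agree with
  the universal quantifiers of \<open>P\<close>.\<close>

locale goedel_doctrine = skolem_doctrine P for P :: "('o, 'm, 'p) doctrine" +
  assumes enough_universal_free: "enough_universal_free (existential_free_subdoctrine P)"

locale first_order_hyperdoctrine = doctrine P for P :: "('o, 'm, 'p) doctrine" +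
  assumes fib_heyting: "A \<in> Obj (base P) \<Longrightarrow> heyting_algebra (fib P A)"
    and sub_heyting_hom: "f \<in> Arr (base P) \<Longrightarrow> heyting_hom (cod_fib P f) (dom_fib P f) (sub P f)"
    and left_adjoint_exists: "f \<in> Arr (base P) \<Longrightarrow> \<exists>l. left_adjoint P f l"
    and right_adjoint_exists: "f \<in> Arr (base P) \<Longrightarrow> \<exists>r. right_adjoint P f r"
    and Exq_Beck_Chevalley: "\<lbrakk>is_pullback (base P) f g h k; \<alpha> \<in> carrier (dom_fib P f)\<rbrakk>
      \<Longrightarrow> Exq P k (sub P h \<alpha>) = sub P g (Exq P f \<alpha>)"
    and Allq_Beck_Chevalley: "\<lbrakk>is_pullback (base P) f g h k; \<alpha> \<in> carrier (dom_fib P f)\<rbrakk>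
      \<Longrightarrow> Allq P k (sub P h \<alpha>) = sub P g (Allq P f \<alpha>)"

locale goedel_first_order_hyperdoctrine = first_order_hyperdoctrine P + goedel_doctrine P
  for P :: "('o, 'm, 'p) doctrine"

text \<open>Finite conjunctions include the empty one, $\top$.\<close>

definition existential_free_closed_under_finite_conjunctions :: "('o, 'm, 'p) doctrine \<Rightarrow> bool"
  where "existential_free_closed_under_finite_conjunctions P \<longleftrightarrow>
    (\<forall>A\<in>Obj (base P). existential_free P A \<top>\<^bsub>fib P A\<^esub> \<and>
      (\<forall>\<alpha> \<beta>. existential_free P A \<alpha> \<and> existential_free P A \<beta> \<longrightarrow>
        existential_free P A (\<alpha> \<sqinter>\<^bsub>fib P A\<^esub> \<beta>)))"

end

theory Submission
  imports Defs
begin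

text \<open>Write $\alpha \to \exists b.\,\beta$ as $\exists c.\,\delta$ with $\delta$ existential-free.
  Then $\delta(a,c) \wedge \alpha(a)$ is existential-free and entails $\exists b.\,\beta(a,b)$, so it
  entails $\beta(a,g(a,c))$ for some arrow $g$. Hence $\delta(a,c)$ entails
  $\alpha(a) \to \beta(a,g(a,c))$, which in turn entails $\exists b.\,(\alpha(a) \to \beta(a,b))$.\<close>

text \<open>Since \<open>himp\<close> is a \<open>SOME\<close>, its properties become available only
  through \<open>himp_exists\<close>. Residuation then combines modus ponens, monotonicity of the
  meet, and maximality of the chosen element.\<close>

lemma (in heyting_algebra)
  assumes "x \<in> carrier L" "y \<in> carrier L"
  shows himp_closed: "x \<Rrightarrow> y \<in> carrier L"
    and le_himp_iff: "w \<in> carrier L \<Longrightarrow> w \<sqsubseteq> x \<Rrightarrow> y \<longleftrightarrow> w \<sqinter> x \<sqsubseteq> y"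
proof -
  have *: "greatest L (x \<Rrightarrow> y) {w \<in> carrier L. w \<sqinter> x \<sqsubseteq> y}"
    unfolding himp_def using himp_exists[OF assms] by (rule someI_ex)
  then show closed: "x \<Rrightarrow> y \<in> carrier L"
    by (rule greatest_closed)
  show "w \<sqsubseteq> x \<Rrightarrow> y \<longleftrightarrow> w \<sqinter> x \<sqsubseteq> y" if w: "w \<in> carrier L"
  proof
    have mp: "(x \<Rrightarrow> y) \<sqinter> x \<sqsubseteq> y"
      using * by (simp add: greatest_def)
    assume "w \<sqsubseteq> x \<Rrightarrow> y"
    then have "w \<sqinter> x \<sqsubseteq> (x \<Rrightarrow> y) \<sqinter> x"
      using w closed assms by (meson le_trans meet_closed meet_le meet_left meet_right)
    with mp show "w \<sqinter> x \<sqsubseteq> y"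
      using w closed assms by (meson le_trans meet_closed)
  next
    assume "w \<sqinter> x \<sqsubseteq> y"
    then show "w \<sqsubseteq> x \<Rrightarrow> y"
      using * w by (simp add: greatest_def)
  qed
qed

lemma (in category) homD:
  assumes "f \<in> hom C A B"
  shows "f \<in> Arr C" "Dom C f = A" "Cod C f = B" "A \<in> Obj C" "B \<in> Obj C"
  using assms Dom_closed Cod_closed by (auto simp: hom_def)

lemma is_productD:
  assumes "is_product C A B X p q"
  shows "A \<in> Obj C" "B \<in> Obj C" "X \<in> Obj C" "p \<in> hom C X A" "q \<in> hom C X B"
  using assms by (auto simp: is_product_def)

lemma is_product_ex1:
  assumes "is_product C A B X p q" "Z \<in> Obj C" "f \<in> hom C Z A" "g \<in> hom C Z B"
  shows "\<exists>!h. h \<in> hom C Z X \<and> p \<cdot>\<^bsub>C\<^esub> h = f \<and> q \<cdot>\<^bsub>C\<^esub> h = g"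
  using assms by (auto simp: is_product_def)

text \<open>\<open>tuple\<close> reads its source and target off \<open>Dom C f\<close> and
  \<open>Dom C p\<close>. Identifying these with \<open>Z\<close> and \<open>X\<close> lets the
  universal property supply the unique existence that \<open>THE\<close> needs.\<close>

lemma (in category) tuple:
  assumes "is_product C A B X p q" "f \<in> hom C Z A" "g \<in> hom C Z B"
  shows tuple_closed: "tuple C p q f g \<in> hom C Z X"
    and proj1_tuple: "p \<cdot> tuple C p q f g = f"
    and proj2_tuple: "q \<cdot> tuple C p q f g = g"
proof -
  have "\<exists>!h. h \<in> hom C (Dom C f) (Dom C p) \<and> p \<cdot> h = f \<and> q \<cdot> h = g"
    using is_product_ex1[OF assms(1) _ assms(2,3)] homD[OF assms(2)]
      homD[OF is_productD(4)[OF assms(1)]] by simp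
  from theI'[OF this] show "tuple C p q f g \<in> hom C Z X" "p \<cdot> tuple C p q f g = f"
      "q \<cdot> tuple C p q f g = g"
    using homD[OF assms(2)] homD[OF is_productD(4)[OF assms(1)]] by (auto simp: tuple_def)
qed

text \<open>The tuple is the product of \<open>f\<close> with the identity of \<open>B\<close>, and
  a cone \<open>(u, v)\<close> is mediated by the arrow into \<open>Y\<close> with components
  \<open>v\<close> and \<open>q \<cdot> u\<close>. This square is what allows Beck-Chevalley to move
  a quantifier along \<open>f\<close>.\<close>

lemma (in category) is_pullback_projection:
  assumes X: "is_product C A B X p q" and Y: "is_product C A' B Y p' q'" and f: "f \<in> hom C A' A"
  shows "is_pullback C p f (tuple C p q (f \<cdot> p') q') p'"
proof -
  note p = is_productD(4,5)[OF X] and p' = is_productD(4,5)[OF Y]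
  let ?t = "tuple C p q (f \<cdot> p') q'"
  note fp' = Comp_closed[OF p'(1) f]
  note t = tuple[OF X fp' p'(2)]
  have "\<exists>!w. w \<in> hom C Z Y \<and> ?t \<cdot> w = u \<and> p' \<cdot> w = v"
    if Z: "Z \<in> Obj C" and u: "u \<in> hom C Z X" and v: "v \<in> hom C Z A'" and eq: "p \<cdot> u = f \<cdot> v"
    for Z u v
  proof -
    \<comment> \<open>Given \<open>p' \<cdot> w = v\<close>, the first components of
      \<open>?t \<cdot> w\<close> and \<open>u\<close> agree by \<open>eq\<close>, so only the
      second ones matter. The pullback property thus reduces to the universal property of
      \<open>Y\<close>.\<close>
    have "?t \<cdot> w = u \<longleftrightarrow> q' \<cdot> w = q \<cdot> u" if w: "w \<in> hom C Z Y" and pw: "p' \<cdot> w = v" for w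
    proof
      assume "?t \<cdot> w = u"
      then show "q' \<cdot> w = q \<cdot> u"
        using Comp_assoc[OF w t(1) p(2)] t(3) by simp
    next
      assume *: "q' \<cdot> w = q \<cdot> u"
      have "p \<cdot> (?t \<cdot> w) = p \<cdot> u"
        using Comp_assoc[OF w t(1) p(1)] Comp_assoc[OF w p'(1) f] t(2) eq pw by simp
      moreover have "q \<cdot> (?t \<cdot> w) = q \<cdot> u"
        using Comp_assoc[OF w t(1) p(2)] t(3) * by simp
      ultimately show "?t \<cdot> w = u"
        using is_product_ex1[OF X Z Comp_closed[OF u p(1)] Comp_closed[OF u p(2)]]
          Comp_closed[OF w t(1)] u by blast
    qed
    then show ?thesis
      using is_product_ex1[OF Y Z v Comp_closed[OF u p(2)]] by metis
  qed
  then show ?thesis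
    using homD[OF p(1)] homD[OF p'(1)] homD[OF f] homD[OF t(1)] t(2)
    by (simp add: is_pullback_def)
qed

context first_order_hyperdoctrine
begin

lemma left_adjoint_Exq: "f \<in> Arr (base P) \<Longrightarrow> left_adjoint P f (Exq P f)"
  unfolding Exq_def using left_adjoint_exists by (rule someI_ex)

text \<open>The instance in which \<beta> is \<open>Exq P f \<alpha>\<close> itself is the unit of
  the adjunction, through which quantified predicates are introduced below.\<close>

lemma
  assumes "f \<in> hom (base P) A B" "\<alpha> \<in> carrier (fib P A)"
  shows Exq_closed: "Exq P f \<alpha> \<in> carrier (fib P B)"
    and Exq_le_iff: "\<beta> \<in> carrier (fib P B) \<Longrightarrow>
      Exq P f \<alpha> \<sqsubseteq>\<^bsub>fib P B\<^esub> \<beta> \<longleftrightarrow> \<alpha> \<sqsubseteq>\<^bsub>fib P A\<^esub> sub P f \<beta>"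
proof -
  have "galois_connection \<lparr>orderA = fib P A, orderB = fib P B, lower = Exq P f, upper = sub P f\<rparr>"
    using left_adjoint_Exq[of f] homD[OF assms(1)] by (simp add: left_adjoint_def)
  then interpret galois_connection
    "\<lparr>orderA = fib P A, orderB = fib P B, lower = Exq P f, upper = sub P f\<rparr>" .
  show "Exq P f \<alpha> \<in> carrier (fib P B)"
    using lower_closed assms(2) by auto
  show "Exq P f \<alpha> \<sqsubseteq>\<^bsub>fib P B\<^esub> \<beta> \<longleftrightarrow> \<alpha> \<sqsubseteq>\<^bsub>fib P A\<^esub> sub P f \<beta>" if "\<beta> \<in> carrier (fib P B)"
    using galois_property assms(2) that by simp
qed

lemma sub_in_carrier:
  assumes "f \<in> hom (base P) A B" "\<alpha> \<in> carrier (fib P B)"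
  shows "sub P f \<alpha> \<in> carrier (fib P A)"
  using sub_closed[of f] homD[OF assms(1)] assms(2) by auto

lemma sub_le:
  assumes "f \<in> hom (base P) A B" "\<alpha> \<in> carrier (fib P B)" "\<beta> \<in> carrier (fib P B)"
    "\<alpha> \<sqsubseteq>\<^bsub>fib P B\<^esub> \<beta>"
  shows "sub P f \<alpha> \<sqsubseteq>\<^bsub>fib P A\<^esub> sub P f \<beta>"
  using sub_mono[of f] homD[OF assms(1)] assms(2-) by (auto simp: isotone_def)

lemma
  assumes "f \<in> hom (base P) A B" "\<alpha> \<in> carrier (fib P B)" "\<beta> \<in> carrier (fib P B)"
  shows sub_meet: "sub P f (\<alpha> \<sqinter>\<^bsub>fib P B\<^esub> \<beta>) = sub P f \<alpha> \<sqinter>\<^bsub>fib P A\<^esub> sub P f \<beta>"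
    and sub_himp: "sub P f (\<alpha> \<Rrightarrow>\<^bsub>fib P B\<^esub> \<beta>) = sub P f \<alpha> \<Rrightarrow>\<^bsub>fib P A\<^esub> sub P f \<beta>"
  using sub_heyting_hom[of f] homD[OF assms(1)] assms(2-) by (auto simp: heyting_hom_def)

end

text \<open>By \<open>sub_Comp\<close>, every reindexing of \<open>sub P f \<alpha>\<close> is a
  reindexing of \<alpha> along a composite, hence already a splitting.\<close>

lemma (in doctrine) existential_free_sub:
  assumes f: "f \<in> hom (base P) A B" and \<alpha>: "existential_free P B \<alpha>"
  shows "existential_free P A (sub P f \<alpha>)"
proof -
  have \<alpha>': "\<alpha> \<in> carrier (fib P B)"
    using \<alpha> by (simp add: existential_free_def)
  have "existential_splitting P Z (sub P g (sub P f \<alpha>))" if "g \<in> hom (base P) Z A" for Z g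
    using sub_Comp[OF that f \<alpha>'] Comp_closed[OF that f] homD(4)[OF that] \<alpha>
    by (metis existential_free_def)
  moreover have "sub P f \<alpha> \<in> carrier (fib P A)"
    using sub_closed[of f] homD[OF f] \<alpha>' by auto
  ultimately show ?thesis
    by (simp add: existential_free_def)
qed

lemma (in doctrine) existential_free_imp_splitting:
  assumes "A \<in> Obj (base P)" "existential_free P A \<alpha>"
  shows "existential_splitting P A \<alpha>"
  using assms Ident_closed[OF assms(1)] sub_Ident[OF assms(1), of \<alpha>]
  by (metis existential_free_def)

text \<open>The arrow \<open>k\<close> is $\langle f, g\rangle$, where $g : Y \to B$ is the witness for $b$.\<close>

lemma (in first_order_hyperdoctrine) existential_free_le_sub_Exq:
  assumes X: "is_product (base P) A B X p q" and \<beta>: "\<beta> \<in> carrier (fib P X)"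
    and f: "f \<in> hom (base P) Y A" and \<gamma>: "existential_free P Y \<gamma>"
    and le: "\<gamma> \<sqsubseteq>\<^bsub>fib P Y\<^esub> sub P f (Exq P p \<beta>)"
  obtains k where "k \<in> hom (base P) Y X" "p \<cdot>\<^bsub>base P\<^esub> k = f" "\<gamma> \<sqsubseteq>\<^bsub>fib P Y\<^esub> sub P k \<beta>"
proof -
  note p = is_productD(4,5)[OF X]
  have Y: "Y \<in> Obj (base P)"
    using homD(4)[OF f] .
  \<comment> \<open>Splitting of \<gamma> concerns predicates on a product of \<open>Y\<close> with
    \<open>B\<close>, so \<beta> must first be transported there. The arrow \<open>t\<close> below,
    \<open>f\<close> times the identity of \<open>B\<close>, does this.\<close>
  obtain Z p' q' where Z: "is_product (base P) Y B Z p' q'"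
    using base_finite_products Y is_productD(2)[OF X] unfolding finite_products_def by blast
  note p' = is_productD(4,5)[OF Z]
  define t where "t = tuple (base P) p q (f \<cdot>\<^bsub>base P\<^esub> p') q'"
  note t = tuple[OF X Comp_closed[OF p'(1) f] p'(2), folded t_def]
  \<comment> \<open>Beck-Chevalley turns the reindexed quantifier in \<open>le\<close> into a
    quantifier along \<open>p'\<close>, the form to which splitting applies.\<close>
  have "Exq P p' (sub P t \<beta>) = sub P f (Exq P p \<beta>)"
    unfolding t_def using Exq_Beck_Chevalley[OF is_pullback_projection[OF X Z f]] \<beta> homD[OF p(1)]
    by simp
  with le existential_free_imp_splitting[OF Y \<gamma>] Z sub_in_carrier[OF t(1) \<beta>]
  obtain g where g: "g \<in> hom (base P) Y B"
      and le': "\<gamma> \<sqsubseteq>\<^bsub>fib P Y\<^esub> sub P (tuple (base P) p' q' (Ident (base P) Y) g) (sub P t \<beta>)"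
    unfolding existential_splitting_def by metis
  \<comment> \<open>\<open>s\<close> is the graph of \<open>g\<close>, so the composite of
    \<open>s\<close> followed by \<open>t\<close> has components \<open>f\<close> and
    \<open>g\<close>.\<close>
  define s where "s = tuple (base P) p' q' (Ident (base P) Y) g"
  note s = tuple[OF Z Ident_closed[OF Y] g, folded s_def]
  show thesis
  proof
    show "t \<cdot>\<^bsub>base P\<^esub> s \<in> hom (base P) Y X"
      using Comp_closed[OF s(1) t(1)] .
    show "p \<cdot>\<^bsub>base P\<^esub> (t \<cdot>\<^bsub>base P\<^esub> s) = f"
      using Comp_assoc[OF s(1) t(1) p(1)] Comp_assoc[OF s(1) p'(1) f] t(2) s(2) Comp_Ident[OF f]
      by simp
    show "\<gamma> \<sqsubseteq>\<^bsub>fib P Y\<^esub> sub P (t \<cdot>\<^bsub>base P\<^esub> s) \<beta>"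
      using le' sub_Comp[OF s(1) t(1) \<beta>] by (simp add: s_def)
  qed
qed

theorem theorem5p7:
  fixes P :: "('o, 'm, 'p) doctrine"
    and A B X :: 'o and p q :: 'm and \<alpha> \<beta> :: 'p
  assumes "goedel_first_order_hyperdoctrine P"
    and "existential_free_closed_under_finite_conjunctions P"
    and "A \<in> Obj (base P)" and "B \<in> Obj (base P)"
    and "is_product (base P) A B X p q"
    and "\<beta> \<in> carrier (fib P X)"
    and "\<alpha> \<in> carrier (fib P A)" and "existential_free P A \<alpha>"
  shows "\<top>\<^bsub>fib P A\<^esub> \<sqsubseteq>\<^bsub>fib P A\<^esub>
    (\<alpha> \<Rrightarrow>\<^bsub>fib P A\<^esub> Exq P p \<beta>) \<Rrightarrow>\<^bsub>fib P A\<^esub> Exq P p (sub P p \<alpha> \<Rrightarrow>\<^bsub>fib P X\<^esub> \<beta>)"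
proof -
  interpret goedel_first_order_hyperdoctrine P
    by fact
  note p = is_productD(3,4)[OF assms(5)]
  interpret A: heyting_algebra "fib P A"
    using fib_heyting assms(3) .
  interpret X: heyting_algebra "fib P X"
    using fib_heyting p(1) .
  define \<epsilon> where "\<epsilon> = Exq P p \<beta>"
  define \<gamma> where "\<gamma> = \<alpha> \<Rrightarrow>\<^bsub>fib P A\<^esub> \<epsilon>"
  define \<eta> where "\<eta> = sub P p \<alpha> \<Rrightarrow>\<^bsub>fib P X\<^esub> \<beta>"
  have \<epsilon>: "\<epsilon> \<in> carrier (fib P A)"
    unfolding \<epsilon>_def using Exq_closed[OF p(2) assms(6)] .
  have \<gamma>: "\<gamma> \<in> carrier (fib P A)"
    unfolding \<gamma>_def using A.himp_closed[OF assms(7) \<epsilon>] .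
  have p\<alpha>: "sub P p \<alpha> \<in> carrier (fib P X)"
    using sub_in_carrier[OF p(2) assms(7)] .
  have \<eta>: "\<eta> \<in> carrier (fib P X)"
    unfolding \<eta>_def using X.himp_closed[OF p\<alpha> assms(6)] .
  have E\<eta>: "Exq P p \<eta> \<in> carrier (fib P A)"
    using Exq_closed[OF p(2) \<eta>] .
  obtain D Y r s \<delta> where Y: "is_product (base P) A D Y r s" and \<delta>: "existential_free P Y \<delta>"
      and \<gamma>_eq: "\<gamma> = Exq P r \<delta>"
    using enough_existential_free assms(3) \<gamma> unfolding enough_existential_free_def by metis
  note r = is_productD(3,4)[OF Y]
  interpret Y: heyting_algebra "fib P Y"
    using fib_heyting r(1) .
  have \<delta>': "\<delta> \<in> carrier (fib P Y)"
    using \<delta> by (simp add: existential_free_def)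
  have r\<alpha>: "sub P r \<alpha> \<in> carrier (fib P Y)" and r\<epsilon>: "sub P r \<epsilon> \<in> carrier (fib P Y)"
    using sub_in_carrier[OF r(2)] assms(7) \<epsilon> by auto
  have "\<delta> \<sqsubseteq>\<^bsub>fib P Y\<^esub> sub P r \<gamma>"
    using Exq_le_iff[OF r(2) \<delta>' \<gamma>] A.le_refl[OF \<gamma>] \<gamma>_eq by simp
  \<comment> \<open>Reindexing preserves implication, so the premise \<alpha> can be moved to the
    left of the entailment over \<open>Y\<close>.\<close>
  then have "\<delta> \<sqinter>\<^bsub>fib P Y\<^esub> sub P r \<alpha> \<sqsubseteq>\<^bsub>fib P Y\<^esub> sub P r \<epsilon>"
    unfolding \<gamma>_def sub_himp[OF r(2) assms(7) \<epsilon>] using Y.le_himp_iff[OF r\<alpha> r\<epsilon> \<delta>'] by simp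
  moreover have "existential_free P Y (\<delta> \<sqinter>\<^bsub>fib P Y\<^esub> sub P r \<alpha>)"
    using assms(2) r(1) \<delta> existential_free_sub[OF r(2) assms(8)]
    by (simp add: existential_free_closed_under_finite_conjunctions_def)
  \<comment> \<open>\<open>k\<close> keeps the \<open>A\<close>-component \<open>r\<close> and adds
    a witness for \<open>b\<close> that may depend on all of \<open>Y\<close>, that is, on both
    \<open>a\<close> and \<open>c\<close>.\<close>
  ultimately obtain k where k: "k \<in> hom (base P) Y X" "p \<cdot>\<^bsub>base P\<^esub> k = r"
      and le: "\<delta> \<sqinter>\<^bsub>fib P Y\<^esub> sub P r \<alpha> \<sqsubseteq>\<^bsub>fib P Y\<^esub> sub P k \<beta>"
    unfolding \<epsilon>_def using existential_free_le_sub_Exq[OF assms(5,6) r(2)] by metis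
  \<comment> \<open>Because \<open>k\<close> lies over \<open>r\<close>, a predicate on
    \<open>A\<close> pulled back to \<open>Y\<close> through \<open>X\<close> is the one pulled back
    directly. Hence \<alpha> can be moved back to the right as the premise of \<eta> at
    \<open>k\<close>.\<close>
  have sub_r: "sub P r \<phi> = sub P k (sub P p \<phi>)" if "\<phi> \<in> carrier (fib P A)" for \<phi>
    using sub_Comp[OF k(1) p(2) that] k(2) by simp
  have "\<delta> \<sqsubseteq>\<^bsub>fib P Y\<^esub> sub P k \<eta>"
    unfolding \<eta>_def sub_himp[OF k(1) p\<alpha> assms(6)] sub_r[OF assms(7), symmetric]
    using Y.le_himp_iff[OF r\<alpha> sub_in_carrier[OF k(1) assms(6)] \<delta>'] le by simp
  \<comment> \<open>This is the unit of the adjunction along \<open>p\<close>, reindexed along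
    \<open>k\<close>: the witness contained in \<open>k\<close> is forgotten.\<close>
  also have "sub P k \<eta> \<sqsubseteq>\<^bsub>fib P Y\<^esub> sub P r (Exq P p \<eta>)"
    unfolding sub_r[OF E\<eta>]
    using Exq_le_iff[OF p(2) \<eta> E\<eta>] A.le_refl[OF E\<eta>] sub_le[OF k(1) \<eta>] sub_in_carrier[OF p(2) E\<eta>]
    by simp
  finally have "\<delta> \<sqsubseteq>\<^bsub>fib P Y\<^esub> sub P r (Exq P p \<eta>)"
    using \<delta>' sub_in_carrier[OF k(1) \<eta>] sub_in_carrier[OF r(2) E\<eta>] by simp
  \<comment> \<open>The bound no longer mentions \<open>c\<close>, so the adjunction along
    \<open>r\<close> quantifies \<open>c\<close> away and restores \<gamma>.\<close>
  then have "\<gamma> \<sqsubseteq>\<^bsub>fib P A\<^esub> Exq P p \<eta>"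
    using Exq_le_iff[OF r(2) \<delta>' E\<eta>] \<gamma>_eq by simp
  then have "\<top>\<^bsub>fib P A\<^esub> \<sqinter>\<^bsub>fib P A\<^esub> \<gamma> \<sqsubseteq>\<^bsub>fib P A\<^esub> Exq P p \<eta>"
    using \<gamma> E\<eta> A.top_closed by (meson A.le_trans A.meet_closed A.meet_right)
  then show ?thesis
    using A.le_himp_iff[OF \<gamma> E\<eta> A.top_closed] unfolding \<gamma>_def \<epsilon>_def \<eta>_def by simp
qed

end
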